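(* Let $\mathbf{B}$ be an Automath book that is ok. Then: (1) $\Delta_{\mathbf{B}}$ is a legal environment in $\lambda$D. (2) The definition (and primitive) lines of $\mathbf{B}$ correspond one-to-one, in order, with the entries of $\Delta_{\mathbf{B}}$: the sequence of constants introduced in these lines of $\mathbf{B}$ equals the sequence of constants defined in the entries of $\Delta_{\mathbf{B}}$; moreover, for each definition line the typing expression $M : A$ of the line equals the one in the corresponding entry of $\Delta_{\mathbf{B}}$, and likewise for each primitive line the typing expression $\mathrm{PN} : A$ equals the one in the corresponding entry. (3) If $\mathbf{B}$ is moreover clean, then every assumption line of $\mathbf{B}$, say with identifier $x$ and category $A$, contributes its declaration $x : A$ to the contexts of exactly those entries $\Gamma_y \rhd c(\gamma_y) := \ldots$ of $\Delta_{\mathbf{B}}$ for which the constant $c$ depends on $x$, i.e. for which $x \in \gamma_y$, where $y$ is the indicator of the line of $\mathbf{B}$ introducing $c$.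
   Context: Terms: fix disjoint infinite sets Var (variables) and Const (constants). Pseudo-terms of the type system $\lambda$D are built from the sorts $\ast$, $\Box$, variables, instantiated constants $c(T_1,\ldots,T_n)$, abstractions $\lambda x{:}T.\,T'$, products $\Pi x{:}T.\,T'$ and applications $T\,T'$. $\lambda$D is the Calculus of Constructions extended with (parametrised) definitions, as in Nederpelt and Geuvers, "Type Theory and Formal Proof" (2014); its judgements have the form $\Delta ; \Gamma \vdash M : N$, where $\Gamma$ is a context $x_1:A_1,\ldots,x_n:A_n$ and $\Delta$ is an environment, i.e. a list of definitions each of the form $\Gamma \rhd c(x_1,\ldots,x_n) := M : A$ or (primitive definition) $\Gamma \rhd c(x_1,\ldots,x_n) := \mathrm{PN} : A$, where $x_1,\ldots,x_n$ are the variables declared in $\Gamma$. An environment $\Delta$ is legal if there are $\Gamma, M, N$ with $\Delta;\Gamma \vdash M : N$ derivable in $\lambda$D. Automath lines have the form $y \ast z := \text{---} : A$ (assumption line, $z\in$ Var), $y \ast c := M : A$ (definition line, $c \in$ Const, $M$ a term) or $y \ast c := \mathrm{PN} : A$ (primitive line), where the indicator $y$ is either the empty symbol $\epsilon$ or a variable, the second entry is the identifier, and $A$ is a term (the category). A book is a finite sequence of lines. A book is coherent if all identifiers of its lines are distinct and every indicator $y \neq \epsilon$ of a line $m$ is the identifier of an assumption line occurring before $m$. For a coherent book and an identifier $z$ of an assumption line $y \ast z := \text{---} : A$, define recursively the subject list $\gamma_z := \gamma_y, z$ and typing context $\Gamma_z := \Gamma_y, z : A$, where $\gamma_\epsilon$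 and $\Gamma_\epsilon$ are empty. The predicate "$\mathbf{B}$ ok" and the environment $\Delta_{\mathbf{B}}$ are defined inductively: the empty book is ok with $\Delta_\epsilon$ empty. If $\mathbf{B}$ is ok, then: $\mathbf{B} + (z \ast x := \text{---} : A)$ is ok provided $x$ does not occur as identifier in $\mathbf{B}$ and $\Delta_{\mathbf{B}};\Gamma_z \vdash A : s$ for some sort $s \in \{\ast,\Box\}$, and then its environment is $\Delta_{\mathbf{B}}$; $\mathbf{B} + (z \ast c := M : A)$ is ok provided $c$ is fresh for $\mathbf{B}$ and $\Delta_{\mathbf{B}};\Gamma_z \vdash M : A$, and then its environment is $\Delta_{\mathbf{B}}, (\Gamma_z \rhd c(\gamma_z) := M : A)$; $\mathbf{B} + (z \ast c := \mathrm{PN} : A)$ is ok provided $c$ is fresh for $\mathbf{B}$ and $\Delta_{\mathbf{B}};\Gamma_z \vdash A : s$ for some sort $s$, and then its environment is $\Delta_{\mathbf{B}}, (\Gamma_z \rhd c(\gamma_z) := \mathrm{PN} : A)$. (Here $\Gamma_\epsilon,\gamma_\epsilon$ are empty when $z=\epsilon$.) An assumption line with identifier $x$ is a dead-end if $x$ is not the indicator of any later line. A coherent book is clean if none of its assumption lines is a dead-end. *)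

theory Defs
  imports Main
begin

section \<open>Pseudo-terms\<close>

text \<open>
  Pseudo-terms are taken up to renaming of bound variables.  The type of preterms is only a
  carrier: free variables are named, bound ones are de Bruijn indices.  The locally closed
  preterms are exactly the alpha-equivalence classes of named pseudo-terms; they form the type
  of pseudo-terms, whose binders are again written with a named bound variable.
\<close>

datatype sort = Star | Box

datatype ('v, 'c) preterm =
    PSort sort
  | PBound nat
  | PVar 'v
  | PConst 'c "('v, 'c) preterm list"
  | PLam "('v, 'c) preterm" "('v, 'c) preterm"
  | PPi "('v, 'c) preterm" "('v, 'c) preterm"
  | PApp "('v, 'c) preterm" "('v, 'c) preterm"

text \<open>All indices that are not bound inside the preterm are below \<open>k\<close>.\<close>

primrec closed_at :: "nat \<Rightarrow> ('v, 'c) preterm \<Rightarrow> bool" where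
  "closed_at k (PSort s) = True"
| "closed_at k (PBound i) = (i < k)"
| "closed_at k (PVar x) = True"
| "closed_at k (PConst c Ts) = list_all (closed_at k) Ts"
| "closed_at k (PLam A M) = (closed_at k A \<and> closed_at (Suc k) M)"
| "closed_at k (PPi A M) = (closed_at k A \<and> closed_at (Suc k) M)"
| "closed_at k (PApp M N) = (closed_at k M \<and> closed_at k N)"

text \<open>Turn the free variable \<open>x\<close> into the variable bound by the \<open>k\<close>-th enclosing binder.\<close>

primrec bind_at :: "nat \<Rightarrow> 'v \<Rightarrow> ('v, 'c) preterm \<Rightarrow> ('v, 'c) preterm" where
  "bind_at k x (PSort s) = PSort s"
| "bind_at k x (PBound i) = PBound i"
| "bind_at k x (PVar y) = (if y = x then PBound k else PVar y)"
| "bind_at k x (PConst c Ts) = PConst c (map (bind_at k x) Ts)"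
| "bind_at k x (PLam A M) = PLam (bind_at k x A) (bind_at (Suc k) x M)"
| "bind_at k x (PPi A M) = PPi (bind_at k x A) (bind_at (Suc k) x M)"
| "bind_at k x (PApp M N) = PApp (bind_at k x M) (bind_at k x N)"

text \<open>
  Simultaneous substitution for the free variables.  No free variable can be captured, since
  the substituted preterms will be locally closed.
\<close>

primrec psubst :: "('v \<Rightarrow> ('v, 'c) preterm) \<Rightarrow> ('v, 'c) preterm \<Rightarrow> ('v, 'c) preterm" where
  "psubst \<sigma> (PSort s) = PSort s"
| "psubst \<sigma> (PBound i) = PBound i"
| "psubst \<sigma> (PVar x) = \<sigma> x"
| "psubst \<sigma> (PConst c Ts) = PConst c (map (psubst \<sigma>) Ts)"
| "psubst \<sigma> (PLam A M) = PLam (psubst \<sigma> A) (psubst \<sigma> M)"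
| "psubst \<sigma> (PPi A M) = PPi (psubst \<sigma> A) (psubst \<sigma> M)"
| "psubst \<sigma> (PApp M N) = PApp (psubst \<sigma> M) (psubst \<sigma> N)"

primrec pfv :: "('v, 'c) preterm \<Rightarrow> 'v set" where
  "pfv (PSort s) = {}"
| "pfv (PBound i) = {}"
| "pfv (PVar x) = {x}"
| "pfv (PConst c Ts) = \<Union> (set (map pfv Ts))"
| "pfv (PLam A M) = pfv A \<union> pfv M"
| "pfv (PPi A M) = pfv A \<union> pfv M"
| "pfv (PApp M N) = pfv M \<union> pfv N"

lemma closed_at_mono: "closed_at k M \<Longrightarrow> k \<le> l \<Longrightarrow> closed_at l M"
  by (induction M arbitrary: k l) (auto simp: list_all_iff)

lemma closed_at_bind_at: "closed_at k M \<Longrightarrow> closed_at (Suc k) (bind_at k x M)"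
  by (induction M arbitrary: k) (auto simp: list_all_iff)

lemma closed_at_psubst:
  "(\<And>x. closed_at 0 (\<sigma> x)) \<Longrightarrow> closed_at k M \<Longrightarrow> closed_at k (psubst \<sigma> M)"
  by (induction M arbitrary: k) (auto simp: list_all_iff intro: closed_at_mono)

typedef ('v, 'c) pterm = "{M :: ('v, 'c) preterm. closed_at 0 M}"
  by (rule exI[of _ "PSort Star"]) simp

setup_lifting type_definition_pterm

lift_definition Sort :: "sort \<Rightarrow> ('v, 'c) pterm" is PSort by simp

lift_definition Var :: "'v \<Rightarrow> ('v, 'c) pterm" is PVar by simp

lift_definition Const :: "'c \<Rightarrow> ('v, 'c) pterm list \<Rightarrow> ('v, 'c) pterm" is PConst
  by (simp add: list_all_iff)

lift_definition Lam :: "'v \<Rightarrow> ('v, 'c) pterm \<Rightarrow> ('v, 'c) pterm \<Rightarrow> ('v, 'c) pterm"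
  is "\<lambda>x A M. PLam A (bind_at 0 x M)"
  by (simp add: closed_at_bind_at)

lift_definition Pi :: "'v \<Rightarrow> ('v, 'c) pterm \<Rightarrow> ('v, 'c) pterm \<Rightarrow> ('v, 'c) pterm"
  is "\<lambda>x A M. PPi A (bind_at 0 x M)"
  by (simp add: closed_at_bind_at)

lift_definition App :: "('v, 'c) pterm \<Rightarrow> ('v, 'c) pterm \<Rightarrow> ('v, 'c) pterm" is PApp
  by simp

lift_definition fv :: "('v, 'c) pterm \<Rightarrow> 'v set" is pfv .

lift_definition subst :: "('v \<Rightarrow> ('v, 'c) pterm) \<Rightarrow> ('v, 'c) pterm \<Rightarrow> ('v, 'c) pterm" is psubst
  by (rule closed_at_psubst)

text \<open>
  The facts below characterize these operations: every pseudo-term is built by the named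
  constructors, abstractions are equal exactly up to renaming, and substitution is
  capture-avoiding.
\<close>

lemma finite_pfv: "finite (pfv M)"
  by (induction M) auto

lemma bind_at_fresh: "x \<notin> pfv M \<Longrightarrow> bind_at k x M = M"
  by (induction M arbitrary: k) (auto intro: map_idI)

lemma pfv_bind_at: "pfv (bind_at k x M) = pfv M - {x}"
  by (induction M arbitrary: k) auto

lemma bind_at_inj:
  "closed_at k M \<Longrightarrow> closed_at k N \<Longrightarrow> bind_at k x M = bind_at k x N \<Longrightarrow> M = N"
proof (induction M arbitrary: k N)
  case (PConst c Ts)
  then obtain Us where N: "N = PConst c Us" by (cases N) (auto split: if_splits)
  have "Ts = Us"
  proof (rule nth_equalityI)
    have *: "map (bind_at k x) Ts = map (bind_at k x) Us" using PConst.prems N by simp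
    show len: "length Ts = length Us" using * by (rule map_eq_imp_length_eq)
    fix i assume i: "i < length Ts"
    have "bind_at k x (Ts ! i) = bind_at k x (Us ! i)" using * len i by (metis nth_map)
    then show "Ts ! i = Us ! i"
      using PConst.IH[of "Ts ! i" k "Us ! i"] PConst.prems N i len by (auto simp: list_all_length)
  qed
  with N show ?case by simp
next
  case (PLam A M)
  then show ?case by (cases N) (auto split: if_splits)
next
  case (PPi A M)
  then show ?case by (cases N) (auto split: if_splits)
next
  case (PApp A M)
  then show ?case by (cases N) (auto split: if_splits)
next
  case (PSort s)
  then show ?case by (cases N) (auto split: if_splits)
next
  case (PBound i)
  then show ?case by (cases N) (auto split: if_splits)
next
  case (PVar y)
  then show ?case by (cases N) (auto split: if_splits)
qed

lemma bind_at_surj: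
  "closed_at (Suc k) M \<Longrightarrow> x \<notin> pfv M \<Longrightarrow> \<exists>N. closed_at k N \<and> M = bind_at k x N"
proof (induction M arbitrary: k)
  case (PSort s)
  show ?case by (rule exI[of _ "PSort s"]) simp
next
  case (PBound i)
  show ?case
  proof (cases "i = k")
    case True
    then show ?thesis by (intro exI[of _ "PVar x"]) simp
  next
    case False
    with PBound show ?thesis by (intro exI[of _ "PBound i"]) simp
  qed
next
  case (PVar y)
  then show ?case by (intro exI[of _ "PVar y"]) simp
next
  case (PConst c Ts)
  then have "\<forall>T\<in>set Ts. \<exists>N. closed_at k N \<and> T = bind_at k x N"
    by (auto simp: list_all_iff)
  then obtain f where f: "\<forall>T\<in>set Ts. closed_at k (f T) \<and> T = bind_at k x (f T)" by metis
  then have "map (bind_at k x \<circ> f) Ts = Ts" by (intro map_idI) simp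
  with f show ?case
    by (intro exI[of _ "PConst c (map f Ts)"]) (auto simp: list_all_iff)
next
  case (PLam A M)
  then obtain A' M' where "closed_at k A'" "A = bind_at k x A'"
    "closed_at (Suc k) M'" "M = bind_at (Suc k) x M'" by fastforce
  then show ?case by (intro exI[of _ "PLam A' M'"]) simp
next
  case (PPi A M)
  then obtain A' M' where "closed_at k A'" "A = bind_at k x A'"
    "closed_at (Suc k) M'" "M = bind_at (Suc k) x M'" by fastforce
  then show ?case by (intro exI[of _ "PPi A' M'"]) simp
next
  case (PApp A M)
  then obtain A' M' where "closed_at k A'" "A = bind_at k x A'"
    "closed_at k M'" "M = bind_at k x M'" by fastforce
  then show ?case by (intro exI[of _ "PApp A' M'"]) simp
qed

lemma bind_at_rename:
  "y \<notin> pfv M \<Longrightarrow> bind_at k y (psubst (PVar(x := PVar y)) M) = bind_at k x M"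
  by (induction M arbitrary: k) auto

lemma psubst_bind_at:
  "(\<And>z. z \<in> pfv M \<Longrightarrow> z \<noteq> x \<Longrightarrow> x \<notin> pfv (\<sigma> z)) \<Longrightarrow>
    psubst \<sigma> (bind_at k x M) = bind_at k x (psubst (\<sigma>(x := PVar x)) M)"
  by (induction M arbitrary: k) (auto simp: bind_at_fresh)

lemma pterm_cases:
  fixes M :: "('v, 'c) pterm"
  assumes "infinite (UNIV :: 'v set)"
  obtains s where "M = Sort s"
  | x where "M = Var x"
  | c Ts where "M = Const c Ts"
  | x A N where "M = Lam x A N"
  | x A N where "M = Pi x A N"
  | N N' where "M = App N N'"
proof -
  have bnd: "\<exists>x N. closed_at 0 N \<and> M' = bind_at 0 x N" if "closed_at 1 M'"
    for M' :: "('v, 'c) preterm"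
  proof -
    obtain x where "x \<notin> pfv M'" using ex_new_if_finite[OF assms finite_pfv] by blast
    with bind_at_surj[of 0 M' x] that show ?thesis by auto
  qed
  have "(\<exists>s. M = Sort s) \<or> (\<exists>x. M = Var x) \<or> (\<exists>c Ts. M = Const c Ts) \<or>
    (\<exists>x A N. M = Lam x A N) \<or> (\<exists>x A N. M = Pi x A N) \<or> (\<exists>N N'. M = App N N')"
  proof (cases "Rep_pterm M")
    case (PSort s)
    then have "M = Sort s" by (metis Rep_pterm_inject Sort.rep_eq)
    then show ?thesis by blast
  next
    case (PBound i)
    then show ?thesis using Rep_pterm[of M] by simp
  next
    case (PVar x)
    then have "M = Var x" by (metis Rep_pterm_inject Var.rep_eq)
    then show ?thesis by blast
  next
    case (PConst c Ts)
    then have "list_all (closed_at 0) Ts" using Rep_pterm[of M] by simp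
    then have "map (Rep_pterm \<circ> Abs_pterm) Ts = Ts"
      by (intro map_idI) (simp add: list_all_iff Abs_pterm_inverse)
    then have "M = Const c (map Abs_pterm Ts)"
      using PConst by (simp add: Rep_pterm_inject[symmetric] Const.rep_eq)
    then show ?thesis by blast
  next
    case (PLam A M')
    then have A: "closed_at 0 A" and "closed_at 1 M'" using Rep_pterm[of M] by auto
    then obtain x N where "closed_at 0 N" "M' = bind_at 0 x N" using bnd by blast
    then have "M = Lam x (Abs_pterm A) (Abs_pterm N)"
      using PLam A by (simp add: Rep_pterm_inject[symmetric] Lam.rep_eq Abs_pterm_inverse)
    then show ?thesis by blast
  next
    case (PPi A M')
    then have A: "closed_at 0 A" and "closed_at 1 M'" using Rep_pterm[of M] by auto
    then obtain x N where "closed_at 0 N" "M' = bind_at 0 x N" using bnd by blast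
    then have "M = Pi x (Abs_pterm A) (Abs_pterm N)"
      using PPi A by (simp add: Rep_pterm_inject[symmetric] Pi.rep_eq Abs_pterm_inverse)
    then show ?thesis by blast
  next
    case (PApp N N')
    then have "closed_at 0 N" "closed_at 0 N'" using Rep_pterm[of M] by auto
    then have "M = App (Abs_pterm N) (Abs_pterm N')"
      using PApp by (simp add: Rep_pterm_inject[symmetric] App.rep_eq Abs_pterm_inverse)
    then show ?thesis by blast
  qed
  then show thesis using that by blast
qed

lemma Lam_inject: "Lam x A M = Lam x B N \<longleftrightarrow> A = B \<and> M = N"
  by transfer (auto dest: bind_at_inj)

lemma Pi_inject: "Pi x A M = Pi x B N \<longleftrightarrow> A = B \<and> M = N"
  by transfer (auto dest: bind_at_inj)

lemma Lam_rename: "y \<notin> fv M \<Longrightarrow> Lam x A M = Lam y A (subst (Var(x := Var y)) M)"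
proof (transfer, goal_cases)
  case (1 y M x A)
  have "(\<lambda>a. if a = x then PVar y else PVar a) = PVar(x := PVar y)" by auto
  with 1 show ?case using bind_at_rename[of y M 0 x] by (simp add: fun_upd_def)
qed

lemma Pi_rename: "y \<notin> fv M \<Longrightarrow> Pi x A M = Pi y A (subst (Var(x := Var y)) M)"
proof (transfer, goal_cases)
  case (1 y M x A)
  have "(\<lambda>a. if a = x then PVar y else PVar a) = PVar(x := PVar y)" by auto
  with 1 show ?case using bind_at_rename[of y M 0 x] by (simp add: fun_upd_def)
qed

lemma fv_simps:
  "fv (Sort s) = {}"
  "fv (Var x) = {x}"
  "fv (Const c Ts) = \<Union> (fv ` set Ts)"
  "fv (Lam x A M) = fv A \<union> (fv M - {x})"
  "fv (Pi x A M) = fv A \<union> (fv M - {x})"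
  "fv (App M N) = fv M \<union> fv N"
  by (simp_all add: fv.rep_eq Sort.rep_eq Var.rep_eq Const.rep_eq Lam.rep_eq Pi.rep_eq
      App.rep_eq pfv_bind_at)

lemma subst_simps:
  "subst \<sigma> (Sort s) = Sort s"
  "subst \<sigma> (Var x) = \<sigma> x"
  "subst \<sigma> (Const c Ts) = Const c (map (subst \<sigma>) Ts)"
  "subst \<sigma> (App M N) = App (subst \<sigma> M) (subst \<sigma> N)"
  by (simp_all add: Rep_pterm_inject[symmetric] subst.rep_eq Sort.rep_eq Var.rep_eq
      Const.rep_eq App.rep_eq comp_def id_def)

lemma subst_binder:
  assumes "\<And>z. z \<in> fv M \<Longrightarrow> z \<noteq> x \<Longrightarrow> x \<notin> fv (\<sigma> z)"
  shows "subst \<sigma> (Lam x A M) = Lam x (subst \<sigma> A) (subst (\<sigma>(x := Var x)) M)"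
    and "subst \<sigma> (Pi x A M) = Pi x (subst \<sigma> A) (subst (\<sigma>(x := Var x)) M)"
proof -
  have "Rep_pterm \<circ> \<sigma>(x := Var x) = (Rep_pterm \<circ> \<sigma>)(x := PVar x)"
    by (auto simp: Var.rep_eq)
  then have *: "psubst (Rep_pterm \<circ> \<sigma>) (bind_at 0 x (Rep_pterm M)) =
      bind_at 0 x (psubst (Rep_pterm \<circ> \<sigma>(x := Var x)) (Rep_pterm M))"
    using assms by (simp only:) (rule psubst_bind_at, simp add: fv.rep_eq)
  show "subst \<sigma> (Lam x A M) = Lam x (subst \<sigma> A) (subst (\<sigma>(x := Var x)) M)"
    using * by (simp add: Rep_pterm_inject[symmetric] subst.rep_eq Lam.rep_eq comp_def id_def)
  show "subst \<sigma> (Pi x A M) = Pi x (subst \<sigma> A) (subst (\<sigma>(x := Var x)) M)"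
    using * by (simp add: Rep_pterm_inject[symmetric] subst.rep_eq Pi.rep_eq comp_def id_def)
qed

text \<open>\<open>M[x\<^sub>1, \<dots>, x\<^sub>n := U\<^sub>1, \<dots>, U\<^sub>n]\<close>, simultaneously.\<close>

definition subst_list :: "'v list \<Rightarrow> ('v, 'c) pterm list \<Rightarrow> ('v, 'c) pterm \<Rightarrow> ('v, 'c) pterm" where
  "subst_list xs Us =
    subst (\<lambda>x. case map_of (zip xs Us) x of None \<Rightarrow> Var x | Some U \<Rightarrow> U)"

definition subst1 :: "'v \<Rightarrow> ('v, 'c) pterm \<Rightarrow> ('v, 'c) pterm \<Rightarrow> ('v, 'c) pterm" where
  "subst1 x N = subst (Var(x := N))"


section \<open>The type system \<open>\<lambda>D\<close>\<close>

type_synonym ('v, 'c) ctx = "('v \<times> ('v, 'c) pterm) list"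

abbreviation dom_ctx :: "('v, 'c) ctx \<Rightarrow> 'v list" where
  "dom_ctx \<Gamma> \<equiv> map fst \<Gamma>"

text \<open>
  \<open>Def \<Gamma> c xs M A\<close> is the entry \<open>\<Gamma> \<rhd> c(xs) := M : A\<close>, and \<open>Prim \<Gamma> c xs A\<close> is
  \<open>\<Gamma> \<rhd> c(xs) := PN : A\<close>.  That \<open>xs\<close> lists the variables declared in \<open>\<Gamma>\<close> is imposed by the
  rules extending an environment.
\<close>

datatype ('v, 'c) entry =
    Def (entry_ctx: "('v, 'c) ctx") (entry_const: 'c) (entry_params: "'v list")
      (entry_body: "('v, 'c) pterm") (entry_type: "('v, 'c) pterm")
  | Prim (entry_ctx: "('v, 'c) ctx") (entry_const: 'c) (entry_params: "'v list")
      (entry_type: "('v, 'c) pterm")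

type_synonym ('v, 'c) env = "('v, 'c) entry list"

inductive red :: "('v, 'c) env \<Rightarrow> ('v, 'c) pterm \<Rightarrow> ('v, 'c) pterm \<Rightarrow> bool"
  for \<Delta> :: "('v, 'c) env" where
  beta: "red \<Delta> (App (Lam x A M) N) (subst1 x N M)"
| delta: "Def \<Gamma> c xs M A \<in> set \<Delta> \<Longrightarrow> length Us = length xs \<Longrightarrow>
    red \<Delta> (Const c Us) (subst_list xs Us M)"
| const: "red \<Delta> U U' \<Longrightarrow> red \<Delta> (Const c (Us @ U # Vs)) (Const c (Us @ U' # Vs))"
| lam_type: "red \<Delta> A A' \<Longrightarrow> red \<Delta> (Lam x A M) (Lam x A' M)"
| lam_body: "red \<Delta> M M' \<Longrightarrow> red \<Delta> (Lam x A M) (Lam x A M')"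
| pi_type: "red \<Delta> A A' \<Longrightarrow> red \<Delta> (Pi x A B) (Pi x A' B)"
| pi_body: "red \<Delta> B B' \<Longrightarrow> red \<Delta> (Pi x A B) (Pi x A B')"
| app_fun: "red \<Delta> M M' \<Longrightarrow> red \<Delta> (App M N) (App M' N)"
| app_arg: "red \<Delta> N N' \<Longrightarrow> red \<Delta> (App M N) (App M N')"

abbreviation conv :: "('v, 'c) env \<Rightarrow> ('v, 'c) pterm \<Rightarrow> ('v, 'c) pterm \<Rightarrow> bool" where
  "conv \<Delta> \<equiv> equivclp (red \<Delta>)"

inductive typing ::
  "('v, 'c) env \<Rightarrow> ('v, 'c) ctx \<Rightarrow> ('v, 'c) pterm \<Rightarrow> ('v, 'c) pterm \<Rightarrow> bool"
  (\<open>(_ \<Zsemi> _ \<turnstile> _ \<Colon> _)\<close> [50, 50, 50, 50] 50) where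
  sort: "[] \<Zsemi> [] \<turnstile> Sort Star \<Colon> Sort Box"
| var: "\<Delta> \<Zsemi> \<Gamma> \<turnstile> A \<Colon> Sort s \<Longrightarrow> x \<notin> set (dom_ctx \<Gamma>) \<Longrightarrow> \<Delta> \<Zsemi> \<Gamma> @ [(x, A)] \<turnstile> Var x \<Colon> A"
| weak: "\<Delta> \<Zsemi> \<Gamma> \<turnstile> A \<Colon> B \<Longrightarrow> \<Delta> \<Zsemi> \<Gamma> \<turnstile> C \<Colon> Sort s \<Longrightarrow> x \<notin> set (dom_ctx \<Gamma>) \<Longrightarrow>
    \<Delta> \<Zsemi> \<Gamma> @ [(x, C)] \<turnstile> A \<Colon> B"
| form: "\<Delta> \<Zsemi> \<Gamma> \<turnstile> A \<Colon> Sort s\<^sub>1 \<Longrightarrow> \<Delta> \<Zsemi> \<Gamma> @ [(x, A)] \<turnstile> B \<Colon> Sort s\<^sub>2 \<Longrightarrow>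
    \<Delta> \<Zsemi> \<Gamma> \<turnstile> Pi x A B \<Colon> Sort s\<^sub>2"
| appl: "\<Delta> \<Zsemi> \<Gamma> \<turnstile> M \<Colon> Pi x A B \<Longrightarrow> \<Delta> \<Zsemi> \<Gamma> \<turnstile> N \<Colon> A \<Longrightarrow>
    \<Delta> \<Zsemi> \<Gamma> \<turnstile> App M N \<Colon> subst1 x N B"
| abst: "\<Delta> \<Zsemi> \<Gamma> @ [(x, A)] \<turnstile> M \<Colon> B \<Longrightarrow> \<Delta> \<Zsemi> \<Gamma> \<turnstile> Pi x A B \<Colon> Sort s \<Longrightarrow>
    \<Delta> \<Zsemi> \<Gamma> \<turnstile> Lam x A M \<Colon> Pi x A B"
| conv: "\<Delta> \<Zsemi> \<Gamma> \<turnstile> A \<Colon> B \<Longrightarrow> \<Delta> \<Zsemi> \<Gamma> \<turnstile> B' \<Colon> Sort s \<Longrightarrow> conv \<Delta> B B' \<Longrightarrow>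
    \<Delta> \<Zsemi> \<Gamma> \<turnstile> A \<Colon> B'"
| def: "\<Delta> \<Zsemi> \<Gamma> \<turnstile> K \<Colon> L \<Longrightarrow> \<Delta> \<Zsemi> \<Gamma>' \<turnstile> M \<Colon> N \<Longrightarrow> a \<notin> set (map entry_const \<Delta>) \<Longrightarrow>
    \<Delta> @ [Def \<Gamma>' a (dom_ctx \<Gamma>') M N] \<Zsemi> \<Gamma> \<turnstile> K \<Colon> L"
| def_prim: "\<Delta> \<Zsemi> \<Gamma> \<turnstile> K \<Colon> L \<Longrightarrow> \<Delta> \<Zsemi> \<Gamma>' \<turnstile> N \<Colon> Sort s \<Longrightarrow> a \<notin> set (map entry_const \<Delta>) \<Longrightarrow>
    \<Delta> @ [Prim \<Gamma>' a (dom_ctx \<Gamma>') N] \<Zsemi> \<Gamma> \<turnstile> K \<Colon> L"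
| inst: "\<Delta> \<Zsemi> \<Gamma> \<turnstile> Sort Star \<Colon> Sort Box \<Longrightarrow> Def \<Gamma>' a xs M N \<in> set \<Delta> \<Longrightarrow>
    length Us = length \<Gamma>' \<Longrightarrow>
    (\<And>i. i < length \<Gamma>' \<Longrightarrow> \<Delta> \<Zsemi> \<Gamma> \<turnstile> Us ! i \<Colon> subst_list xs Us (snd (\<Gamma>' ! i))) \<Longrightarrow>
    \<Delta> \<Zsemi> \<Gamma> \<turnstile> Const a Us \<Colon> subst_list xs Us N"
| inst_prim: "\<Delta> \<Zsemi> \<Gamma> \<turnstile> Sort Star \<Colon> Sort Box \<Longrightarrow> Prim \<Gamma>' a xs N \<in> set \<Delta> \<Longrightarrow>
    length Us = length \<Gamma>' \<Longrightarrow>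
    (\<And>i. i < length \<Gamma>' \<Longrightarrow> \<Delta> \<Zsemi> \<Gamma> \<turnstile> Us ! i \<Colon> subst_list xs Us (snd (\<Gamma>' ! i))) \<Longrightarrow>
    \<Delta> \<Zsemi> \<Gamma> \<turnstile> Const a Us \<Colon> subst_list xs Us N"

definition legal_env :: "('v, 'c) env \<Rightarrow> bool" where
  "legal_env \<Delta> \<longleftrightarrow> (\<exists>\<Gamma> M N. \<Delta> \<Zsemi> \<Gamma> \<turnstile> M \<Colon> N)"


section \<open>Automath books\<close>

text \<open>The first argument of each constructor is the indicator, with \<open>None\<close> for \<open>\<epsilon>\<close>.\<close>

datatype ('v, 'c) line =
    is_AssumptionLine: AssumptionLine (indicator: "'v option") 'v "('v, 'c) pterm"
  | DefinitionLine (indicator: "'v option") (line_const: 'c) "('v, 'c) pterm" "('v, 'c) pterm"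
  | PrimitiveLine (indicator: "'v option") (line_const: 'c) "('v, 'c) pterm"

type_synonym ('v, 'c) book = "('v, 'c) line list"

primrec ident :: "('v, 'c) line \<Rightarrow> 'v + 'c" where
  "ident (AssumptionLine y z A) = Inl z"
| "ident (DefinitionLine y c M A) = Inr c"
| "ident (PrimitiveLine y c A) = Inr c"

definition assumed :: "('v, 'c) book \<Rightarrow> 'v \<Rightarrow> bool" where
  "assumed B x \<longleftrightarrow> (\<exists>y A. AssumptionLine y x A \<in> set B)"

definition coherent :: "('v, 'c) book \<Rightarrow> bool" where
  "coherent B \<longleftrightarrow> distinct (map ident B) \<and>
    (\<forall>m<length B. \<forall>y. indicator (B ! m) = Some y \<longrightarrow> assumed (take m B) y)"

text \<open>
  \<open>\<Gamma>\<^sub>y\<close> and \<open>\<gamma>\<^sub>y\<close>, computed on the book read backwards so that the recursion is structural;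
  the intended recursion equations are derived below for coherent books.
\<close>

fun ctx_rev :: "('v, 'c) line list \<Rightarrow> 'v option \<Rightarrow> ('v, 'c) ctx" where
  "ctx_rev L None = []"
| "ctx_rev [] (Some z) = []"
| "ctx_rev (l # L) (Some z) = (case l of
      AssumptionLine y x A \<Rightarrow> if x = z then ctx_rev L y @ [(z, A)] else ctx_rev L (Some z)
    | _ \<Rightarrow> ctx_rev L (Some z))"

fun subjects_rev :: "('v, 'c) line list \<Rightarrow> 'v option \<Rightarrow> 'v list" where
  "subjects_rev L None = []"
| "subjects_rev [] (Some z) = []"
| "subjects_rev (l # L) (Some z) = (case l of
      AssumptionLine y x A \<Rightarrow> if x = z then subjects_rev L y @ [z] else subjects_rev L (Some z)
    | _ \<Rightarrow> subjects_rev L (Some z))"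

definition typing_context :: "('v, 'c) book \<Rightarrow> 'v option \<Rightarrow> ('v, 'c) ctx" where
  "typing_context B = ctx_rev (rev B)"

definition subject_list :: "('v, 'c) book \<Rightarrow> 'v option \<Rightarrow> 'v list" where
  "subject_list B = subjects_rev (rev B)"

lemma typing_context_None: "typing_context B None = []"
  by (simp add: typing_context_def)

lemma subject_list_None: "subject_list B None = []"
  by (simp add: subject_list_def)

lemma coherent_snoc:
  "coherent (B @ [l]) \<longleftrightarrow>
    coherent B \<and> ident l \<notin> set (map ident B) \<and> (\<forall>y. indicator l = Some y \<longrightarrow> assumed B y)"
  unfolding coherent_def by (auto simp: nth_append less_Suc_eq)

lemma not_assumed_if_fresh: "ident l \<notin> set (map ident B) \<Longrightarrow> assumed B y \<Longrightarrow> ident l \<noteq> Inl y"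
  by (force simp: assumed_def)

lemma snoc_other:
  assumes "ident l \<noteq> Inl z"
  shows "typing_context (B @ [l]) (Some z) = typing_context B (Some z)"
    and "subject_list (B @ [l]) (Some z) = subject_list B (Some z)"
  using assms by (cases l; simp add: typing_context_def subject_list_def)+

lemma coherent_assumption:
  assumes "coherent B" and "AssumptionLine y z A \<in> set B"
  shows typing_context_Some: "typing_context B (Some z) = typing_context B y @ [(z, A)]"
    and subject_list_Some: "subject_list B (Some z) = subject_list B y @ [z]"
proof -
  have "typing_context B (Some z) = typing_context B y @ [(z, A)] \<and>
    subject_list B (Some z) = subject_list B y @ [z]"
    using assms
  proof (induction B rule: rev_induct)
    case (snoc l B)
    note coh = snoc.prems(1)[unfolded coherent_snoc]
    have stable: "typing_context (B @ [l]) y = typing_context B y \<and>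
        subject_list (B @ [l]) y = subject_list B y"
      if "\<And>v. y = Some v \<Longrightarrow> assumed B v"
    proof (cases y)
      case (Some v)
      then show ?thesis
        using that coh not_assumed_if_fresh[of l B v] snoc_other[of l v B] by simp
    qed (simp add: typing_context_def subject_list_def)
    show ?case
    proof (cases "l = AssumptionLine y z A")
      case True
      then show ?thesis
        using stable coh by (simp add: typing_context_def subject_list_def)
    next
      case False
      then have mem: "AssumptionLine y z A \<in> set B" using snoc.prems by simp
      then obtain m where "m < length B" "B ! m = AssumptionLine y z A"
        by (auto simp: in_set_conv_nth)
      then have "\<And>v. y = Some v \<Longrightarrow> assumed B v"
        using coh unfolding coherent_def assumed_def by (metis in_set_takeD line.sel(1))
      moreover have "ident l \<noteq> Inl z" using coh mem by force
      ultimately show ?thesis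
        using snoc.IH coh mem stable snoc_other[of l z B] by simp
    qed
  qed simp
  then show "typing_context B (Some z) = typing_context B y @ [(z, A)]"
    and "subject_list B (Some z) = subject_list B y @ [z]" by auto
qed

text \<open>
  \<open>ok_env B \<Delta>\<close>: the book \<open>B\<close> is ok and its environment is \<open>\<Delta>\<close>.  The first premise of the
  extension rules makes \<open>\<Gamma>\<^sub>z\<close> and \<open>\<gamma>\<^sub>z\<close> meaningful.
\<close>

inductive ok_env :: "('v, 'c) book \<Rightarrow> ('v, 'c) env \<Rightarrow> bool" where
  empty: "ok_env [] []"
| assm_line: "ok_env B \<Delta> \<Longrightarrow> (\<And>y. z = Some y \<Longrightarrow> assumed B y) \<Longrightarrow> Inl x \<notin> set (map ident B) \<Longrightarrow>
    \<Delta> \<Zsemi> typing_context B z \<turnstile> A \<Colon> Sort s \<Longrightarrow>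
    ok_env (B @ [AssumptionLine z x A]) \<Delta>"
| def_line: "ok_env B \<Delta> \<Longrightarrow> (\<And>y. z = Some y \<Longrightarrow> assumed B y) \<Longrightarrow> Inr c \<notin> set (map ident B) \<Longrightarrow>
    \<Delta> \<Zsemi> typing_context B z \<turnstile> M \<Colon> A \<Longrightarrow>
    ok_env (B @ [DefinitionLine z c M A]) (\<Delta> @ [Def (typing_context B z) c (subject_list B z) M A])"
| prim_line: "ok_env B \<Delta> \<Longrightarrow> (\<And>y. z = Some y \<Longrightarrow> assumed B y) \<Longrightarrow> Inr c \<notin> set (map ident B) \<Longrightarrow>
    \<Delta> \<Zsemi> typing_context B z \<turnstile> A \<Colon> Sort s \<Longrightarrow>
    ok_env (B @ [PrimitiveLine z c A]) (\<Delta> @ [Prim (typing_context B z) c (subject_list B z) A])"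

definition ok :: "('v, 'c) book \<Rightarrow> bool" where
  "ok B \<longleftrightarrow> (\<exists>\<Delta>. ok_env B \<Delta>)"

definition env_of :: "('v, 'c) book \<Rightarrow> ('v, 'c) env" where
  "env_of B = (THE \<Delta>. ok_env B \<Delta>)"

lemma ok_env_unique: "ok_env B \<Delta> \<Longrightarrow> ok_env B \<Delta>' \<Longrightarrow> \<Delta>' = \<Delta>"
proof (induction arbitrary: \<Delta>' rule: ok_env.induct)
  case empty
  then show ?case by cases auto
next
  case (assm_line B \<Delta> z x A s)
  from assm_line.prems show ?case by cases (auto intro: assm_line.IH)
next
  case (def_line B \<Delta> z c M A)
  from def_line.prems show ?case by cases (auto intro: def_line.IH)
next
  case (prim_line B \<Delta> z c A s)
  from prim_line.prems show ?case by cases (auto intro: prim_line.IH)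
qed

lemma env_of_eq: "ok_env B \<Delta> \<Longrightarrow> env_of B = \<Delta>"
  unfolding env_of_def by (blast intro: the_equality ok_env_unique)

definition const_lines :: "('v, 'c) book \<Rightarrow> ('v, 'c) line list" where
  "const_lines B = filter (\<lambda>l. \<not> is_AssumptionLine l) B"

definition dead_end :: "('v, 'c) book \<Rightarrow> nat \<Rightarrow> bool" where
  "dead_end B k \<longleftrightarrow> k < length B \<and> (\<exists>y x A. B ! k = AssumptionLine y x A \<and>
    (\<forall>m. k < m \<and> m < length B \<longrightarrow> indicator (B ! m) \<noteq> Some x))"

definition clean :: "('v, 'c) book \<Rightarrow> bool" where
  "clean B \<longleftrightarrow> coherent B \<and> (\<forall>k. \<not> dead_end B k)"

definition depends_on :: "('v, 'c) book \<Rightarrow> 'c \<Rightarrow> 'v \<Rightarrow> bool" where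
  "depends_on B c x \<longleftrightarrow>
    (\<exists>l\<in>set B. ident l = Inr c \<and> x \<in> set (subject_list B (indicator l)))"

end

theory Submission
  imports Defs
begin

text \<open>
  Freshness of identifiers makes \<open>\<Gamma>\<^sub>z\<close> and \<open>\<gamma>\<^sub>z\<close> stable under extension of the book, so \<open>\<Delta>\<^sub>B\<close> is
  obtained by translating the constant lines of \<open>B\<close> one by one, with contexts read off in the
  whole book.  Legality is preserved since the very judgement that admits a line also types
  something in the environment before that line.  For the contribution of an assumption line of a
  clean book, follow indicators forward: the chain of assumption lines cannot end in a dead-end,
  hence reaches a constant line, whose subject list contains all variables of the chain.
\<close>

text \<open>The rules of \<open>ok_env\<close> record \<open>subject_list\<close> as parameters,
  whereas \<open>typing.def\<close> and \<open>typing.def_prim\<close> demand \<open>dom_ctx\<close>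
  of the context.\<close>

lemma dom_typing_context:
  fixes B :: "('v, 'c) book"
  shows "dom_ctx (typing_context B z) = subject_list B z"
proof -
  have "dom_ctx (ctx_rev L z) = subjects_rev L z" for L :: "('v, 'c) book"
    by (induction L z rule: ctx_rev.induct) (auto split: line.split)
  then show ?thesis by (simp add: typing_context_def subject_list_def)
qed

lemma typing_context_assumption:
  assumes "(x, A) \<in> set (typing_context B z)"
  shows "\<exists>y. AssumptionLine y x A \<in> set B"
proof -
  have "(x, A) \<in> set (ctx_rev L z) \<Longrightarrow> \<exists>y. AssumptionLine y x A \<in> set L" for L
    by (induction L z rule: ctx_rev.induct) (auto split: line.splits if_splits)
  from this[of "rev B"] show ?thesis using assms by (simp add: typing_context_def)
qed

text \<open>Distinct identifiers rule out shadowing: once the backward scan for \<open>y\<close>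
  reaches the line of \<open>z\<close>, it continues exactly as the scan for \<open>z\<close>
  does.\<close>

lemma subject_list_trans:
  fixes B :: "('v, 'c) book"
  assumes "distinct (map ident B)" and "z \<in> set (subject_list B y)"
  shows "set (subject_list B (Some z)) \<subseteq> set (subject_list B y)"
proof -
  have ident: "Inl z \<in> set (map ident L)" if "z \<in> set (subjects_rev L y)"
    for L :: "('v, 'c) book" and y z
    using that by (induction L y rule: subjects_rev.induct) (force split: line.splits if_splits)+
  have "set (subjects_rev L (Some z)) \<subseteq> set (subjects_rev L y)"
    if "distinct (map ident L)" and "z \<in> set (subjects_rev L y)" for L :: "('v, 'c) book"
    using that
  proof (induction L y rule: subjects_rev.induct)
    case (3 l L w)
    show ?case
    proof (cases l)
      case (AssumptionLine y x A)
      show ?thesis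
      proof (cases "z = x")
        case True
        \<comment> \<open>If the scan for \<open>w\<close> skipped this line, \<open>z\<close> would
          be declared again in \<open>L\<close>, against distinctness; so \<open>w = z\<close> and
          the lists coincide.\<close>
        with AssumptionLine 3 ident[of z L "Some w"] show ?thesis by (auto split: if_splits)
      next
        case False
        with AssumptionLine 3 show ?thesis by (fastforce split: if_splits)
      qed
    qed (use 3 in auto)
  qed auto
  from this[of "rev B"] show ?thesis using assms
    by (simp add: subject_list_def rev_map[symmetric])
qed

lemma coherent_if_ok_env: "ok_env B \<Delta> \<Longrightarrow> coherent B"
proof (induction rule: ok_env.induct)
  case empty
  show ?case by (simp add: coherent_def)
qed (simp_all add: coherent_snoc)

lemma coherent_indicator_assumed:
  assumes "coherent B" and "l \<in> set B" and "indicator l = Some y"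
  shows "assumed B y"
proof -
  obtain m where "m < length B" "B ! m = l" using assms(2) by (auto simp: in_set_conv_nth)
  with assms have "assumed (take m B) y" by (auto simp: coherent_def)
  then show ?thesis by (auto simp: assumed_def dest: in_set_takeD)
qed

lemma snoc_stable:
  assumes "ident l \<notin> set (map ident B)" and "\<And>y. z = Some y \<Longrightarrow> assumed B y"
  shows "typing_context (B @ [l]) z = typing_context B z"
    and "subject_list (B @ [l]) z = subject_list B z"
  using assms not_assumed_if_fresh[OF assms(1)]
  by (cases z; simp add: snoc_other typing_context_None subject_list_None)+

text \<open>The book argument allows contexts to be read off in the whole book instead of the prefix
  before the line. Assumption lines yield no entry, so their value is a dummy.\<close>

fun entry_of :: "('v, 'c) book \<Rightarrow> ('v, 'c) line \<Rightarrow> ('v, 'c) entry" where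
  "entry_of B (DefinitionLine z c M A) = Def (typing_context B z) c (subject_list B z) M A"
| "entry_of B (PrimitiveLine z c A) = Prim (typing_context B z) c (subject_list B z) A"
| "entry_of B (AssumptionLine z x A) = undefined"

lemma entry_of_sels:
  assumes "\<not> is_AssumptionLine l"
  shows "entry_const (entry_of B l) = line_const l"
    and "entry_ctx (entry_of B l) = typing_context B (indicator l)"
  using assms by (cases l; simp)+

lemma ident_const_line: "\<not> is_AssumptionLine l \<Longrightarrow> ident l = Inr (line_const l)"
  by (cases l) auto

lemma entry_of_snoc:
  assumes "coherent (B @ [l])" and "k \<in> set (const_lines B)"
  shows "entry_of (B @ [l]) k = entry_of B k"
proof -
  have "k \<in> set B" using assms(2) by (simp add: const_lines_def)
  with assms(1) have "\<And>y. indicator k = Some y \<Longrightarrow> assumed B y"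
    by (metis coherent_indicator_assumed coherent_snoc)
  then show ?thesis
    using snoc_stable[of l B "indicator k"] assms by (cases k) (auto simp: coherent_snoc const_lines_def)
qed

text \<open>Appending a line changes neither the entries of earlier constant lines
  (\<open>entry_of_snoc\<close>) nor the context of its own indicator (\<open>snoc_stable\<close>).
  This closed form gives the order-preserving correspondence and later lets lines stand for
  entries.\<close>

lemma env_eq_map_entry_of: "ok_env B \<Delta> \<Longrightarrow> \<Delta> = map (entry_of B) (const_lines B)"
proof (induction rule: ok_env.induct)
  case empty
  show ?case by (simp add: const_lines_def)
next
  case (assm_line B \<Delta> z x A s)
  let ?l = "AssumptionLine z x A"
  have "coherent (B @ [?l])"
    using ok_env.assm_line[OF assm_line.hyps] by (rule coherent_if_ok_env)
  then have "map (entry_of (B @ [?l])) (const_lines B) = map (entry_of B) (const_lines B)"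
    by (intro map_cong refl entry_of_snoc)
  then show ?case using assm_line.IH by (simp add: const_lines_def)
next
  case (def_line B \<Delta> z c M A)
  let ?l = "DefinitionLine z c M A"
  have "coherent (B @ [?l])"
    using ok_env.def_line[OF def_line.hyps] by (rule coherent_if_ok_env)
  then have "map (entry_of (B @ [?l])) (const_lines B) = map (entry_of B) (const_lines B)"
    by (intro map_cong refl entry_of_snoc)
  then show ?case
    using def_line.IH def_line.hyps snoc_stable[of ?l B z] by (simp add: const_lines_def)
next
  case (prim_line B \<Delta> z c A s)
  let ?l = "PrimitiveLine z c A"
  have "coherent (B @ [?l])"
    using ok_env.prim_line[OF prim_line.hyps] by (rule coherent_if_ok_env)
  then have "map (entry_of (B @ [?l])) (const_lines B) = map (entry_of B) (const_lines B)"
    by (intro map_cong refl entry_of_snoc)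
  then show ?case
    using prim_line.IH prim_line.hyps snoc_stable[of ?l B z] by (simp add: const_lines_def)
qed

lemma entry_consts_if_ok_env:
  "ok_env B \<Delta> \<Longrightarrow> map entry_const \<Delta> = map line_const (const_lines B)"
  by (drule env_eq_map_entry_of) (simp add: const_lines_def entry_of_sels)

text \<open>Provides the side condition for extending an environment: every constant of
  \<open>\<Delta>\<close> stems from a line of \<open>B\<close>.\<close>

lemma entry_const_fresh:
  assumes "ok_env B \<Delta>" and "Inr c \<notin> set (map ident B)"
  shows "c \<notin> set (map entry_const \<Delta>)"
proof
  assume "c \<in> set (map entry_const \<Delta>)"
  then obtain l where "l \<in> set B" "ident l = Inr c"
    unfolding entry_consts_if_ok_env[OF assms(1)]
    by (auto simp: const_lines_def ident_const_line)
  with assms(2) show False by force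
qed

lemma legal_env_if_ok_env: "ok_env B \<Delta> \<Longrightarrow> legal_env \<Delta>"
proof (induction rule: ok_env.induct)
  case empty
  show ?case unfolding legal_env_def using typing.sort by blast
next
  case (def_line B \<Delta> z c M A)
  have "\<Delta> @ [Def (typing_context B z) c (subject_list B z) M A] \<Zsemi> typing_context B z \<turnstile> M \<Colon> A"
    \<comment> \<open>The same judgement fills both premises: the one carried over and the one
      validating the new entry.\<close>
    using typing.def[OF def_line.hyps(4) def_line.hyps(4) entry_const_fresh] def_line.hyps
    by (simp add: dom_typing_context)
  then show ?case unfolding legal_env_def by blast
next
  case (prim_line B \<Delta> z c A s)
  have "\<Delta> @ [Prim (typing_context B z) c (subject_list B z) A] \<Zsemi> typing_context B z \<turnstile> A \<Colon> Sort s"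
    using typing.def_prim[OF prim_line.hyps(4) prim_line.hyps(4) entry_const_fresh] prim_line.hyps
    by (simp add: dom_typing_context)
  then show ?case unfolding legal_env_def by blast
\<comment> \<open>An assumption line keeps the environment, so its case is the induction hypothesis
  itself.\<close>
qed

lemma coherent_ident_inj:
  "coherent B \<Longrightarrow> l \<in> set B \<Longrightarrow> l' \<in> set B \<Longrightarrow> ident l = ident l' \<Longrightarrow> l = l'"
  by (auto simp: coherent_def distinct_map dest: inj_onD)

text \<open>A variable has a single assumption line, so a context can declare \<open>x\<close> only
  with the category \<open>A\<close>.\<close>

lemma declared_iff_subject:
  assumes "coherent B" and "AssumptionLine y x A \<in> set B"
  shows "(x, A) \<in> set (typing_context B z) \<longleftrightarrow> x \<in> set (subject_list B z)"
proof
  assume "x \<in> set (subject_list B z)"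
  then obtain A' where A': "(x, A') \<in> set (typing_context B z)"
    by (auto simp flip: dom_typing_context)
  then obtain y' where "AssumptionLine y' x A' \<in> set B"
    using typing_context_assumption by metis
  then have "A' = A" using coherent_ident_inj[OF assms(1) assms(2)] by fastforce
  with A' show "(x, A) \<in> set (typing_context B z)" by simp
qed (force simp flip: dom_typing_context)

text \<open>By distinctness of identifiers, the line quantified in \<open>depends_on\<close> can
  only be \<open>l\<close>.\<close>

lemma depends_on_line_const:
  assumes "coherent B" and "l \<in> set (const_lines B)"
  shows "depends_on B (line_const l) x \<longleftrightarrow> x \<in> set (subject_list B (indicator l))"
proof -
  have l: "l \<in> set B" "ident l = Inr (line_const l)"
    using assms(2) by (auto simp: const_lines_def ident_const_line)
  then show ?thesis
    unfolding depends_on_def using coherent_ident_inj[OF assms(1)] by metis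
qed

lemma clean_subject:
  assumes "clean B" and "k < length B" and "B ! k = AssumptionLine y x A"
  shows "\<exists>l\<in>set (const_lines B). x \<in> set (subject_list B (indicator l))"
  using assms(2,3)
\<comment> \<open>The measure is the distance to the end of the book; it drops because a line with
  indicator \<open>x\<close> is found strictly later.\<close>
proof (induction "length B - k" arbitrary: k y x A rule: less_induct)
  case less
  have coh: "coherent B" using assms(1) by (simp add: clean_def)
  have "\<not> dead_end B k" using assms(1) by (simp add: clean_def)
  with less.prems obtain m where m: "k < m" "m < length B" "indicator (B ! m) = Some x"
    by (auto simp: dead_end_def)
  have "AssumptionLine y x A \<in> set B" using less.prems by (metis nth_mem)
  then have x: "x \<in> set (subject_list B (Some x))" by (simp add: subject_list_Some[OF coh])
  show ?case
  proof (cases "is_AssumptionLine (B ! m)")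
    case True
    then obtain z C where z: "B ! m = AssumptionLine (Some x) z C"
      using m(3) by (cases "B ! m") auto
    then obtain l where l: "l \<in> set (const_lines B)" "z \<in> set (subject_list B (indicator l))"
      using less.hyps[of m] m by fastforce
    have "AssumptionLine (Some x) z C \<in> set B" using z m by (metis nth_mem)
    \<comment> \<open>The list of \<open>z\<close> extends that of its indicator \<open>x\<close>,
      and transitivity carries \<open>x\<close> on to the list for \<open>l\<close>.\<close>
    then have "x \<in> set (subject_list B (Some z))" using x by (simp add: subject_list_Some[OF coh])
    with l show ?thesis using coh subject_list_trans[of B z] by (auto simp: coherent_def)
  next
    case False
    then have "B ! m \<in> set (const_lines B)" using m by (simp add: const_lines_def)
    with m x show ?thesis by metis
  qed
qed

theorem theorem4:
  fixes B :: "('v, 'c) book"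
  assumes "infinite (UNIV :: 'v set)" and "infinite (UNIV :: 'c set)"
    and "ok B"
  shows "legal_env (env_of B)
    \<and> (map line_const (const_lines B) = map entry_const (env_of B)
      \<and> (\<forall>i<length (const_lines B). \<forall>y c M A.
          const_lines B ! i = DefinitionLine y c M A \<longrightarrow>
          (\<exists>\<Gamma> xs. env_of B ! i = Def \<Gamma> c xs M A))
      \<and> (\<forall>i<length (const_lines B). \<forall>y c A.
          const_lines B ! i = PrimitiveLine y c A \<longrightarrow>
          (\<exists>\<Gamma> xs. env_of B ! i = Prim \<Gamma> c xs A)))
    \<and> (clean B \<longrightarrow>
        (\<forall>y' x A. AssumptionLine y' x A \<in> set B \<longrightarrow>
          {e \<in> set (env_of B). (x, A) \<in> set (entry_ctx e)} =
          {e \<in> set (env_of B). depends_on B (entry_const e) x}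
          \<and> {e \<in> set (env_of B). (x, A) \<in> set (entry_ctx e)} \<noteq> {}))"
proof -
  obtain \<Delta> where ok: "ok_env B \<Delta>" using assms(3) by (auto simp: ok_def)
  note env = env_of_eq[OF ok]
  note \<Delta> = env_eq_map_entry_of[OF ok]
  note coh = coherent_if_ok_env[OF ok]
  have ctx: "{e \<in> set \<Delta>. (x, A) \<in> set (entry_ctx e)} = {e \<in> set \<Delta>. depends_on B (entry_const e) x}"
    (is ?eq)
    and nonempty: "clean B \<Longrightarrow> {e \<in> set \<Delta>. (x, A) \<in> set (entry_ctx e)} \<noteq> {}"
    if "AssumptionLine y' x A \<in> set B" for y' x A
  proof -
    \<comment> \<open>Every entry is \<open>entry_of B l\<close> for a constant line
      \<open>l\<close>, so declaring \<open>x : A\<close> and depending on \<open>x\<close> both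
      reduce to membership in one subject list.\<close>
    have ctx_iff: "(x, A) \<in> set (entry_ctx (entry_of B l)) \<longleftrightarrow> x \<in> set (subject_list B (indicator l))"
      if "l \<in> set (const_lines B)" for l
      using that declared_iff_subject[OF coh \<open>AssumptionLine y' x A \<in> set B\<close>]
      by (simp add: const_lines_def entry_of_sels)
    moreover have "entry_const (entry_of B l) = line_const l" if "l \<in> set (const_lines B)" for l
      using that by (simp add: const_lines_def entry_of_sels)
    ultimately show ?eq
      unfolding \<Delta> using depends_on_line_const[OF coh] by auto
    assume "clean B"
    \<comment> \<open>The constant line at the end of the chain supplies the witness entry.\<close>
    then obtain l where "l \<in> set (const_lines B)" "x \<in> set (subject_list B (indicator l))"
      using clean_subject \<open>AssumptionLine y' x A \<in> set B\<close> by (metis in_set_conv_nth)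
    with ctx_iff show "{e \<in> set \<Delta>. (x, A) \<in> set (entry_ctx e)} \<noteq> {}"
      unfolding \<Delta> by auto
  qed
  have "\<Delta> ! i = entry_of B (const_lines B ! i)" if "i < length (const_lines B)" for i
    using that \<Delta> by simp
  then show ?thesis
    unfolding env
    using legal_env_if_ok_env[OF ok] entry_consts_if_ok_env[OF ok] ctx nonempty by auto
qed

end
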